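(* Let $W:\mathbf{R}^d\times\mathbf{R}^d\to\mathbf{R}$ be a symmetric ($W(x,y)=W(y,x)$) $\mathrm{C}^2$ function, and let $$H_W(x,y):=\begin{bmatrix}\nabla_1^2W(x,y)&\nabla_1\nabla_2W(x,y)\\ \nabla_2\nabla_1W(x,y)&\nabla_2^2W(x,y)\end{bmatrix}.$$ Assume that $r_W:=\sup_{x,y\in\mathbf{R}^d}\sigma(H_W(x,y))$ is finite, where $\sigma$ denotes the spectral radius of a square matrix. Then the functional $\mathcal{W}(\mu):=\frac12\int\int W(x,y)\,\mathrm{d}\mu(x)\,\mathrm{d}\mu(y)$ on $\mathcal{P}_2(\mathbf{R}^d)$, with gradient $\mathcal{G}_{\mathcal{W}}[\mu](x)=\int\nabla_1W(x,y)\,\mathrm{d}\mu(y)$, is transport $L$-smooth with $L=r_W$.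
   Context: $\mathcal{P}_2(\mathbf{R}^d)$ is the set of probability measures on $\mathbf{R}^d$ with finite second-order moment; $F_\#\mu$ is the push-forward of $\mu$ by $F$; $\|\cdot\|$, $\langle\cdot,\cdot\rangle$ are the Euclidean norm and inner product; $\nabla_1,\nabla_2$ are the gradient operators with respect to the first and second variables in $\mathbf{R}^d$, so $H_W$ is the full $2d\times2d$ Hessian of $W$; $L^2(\mathbf{R}^d\to\mathbf{R}^d)$ is the set of maps $\mathbf{R}^d\to\mathbf{R}^d$ that are square integrable with respect to the base measure $\mu$. Transport $L$-smooth: a functional $\mathcal{F}:\mathcal{P}_2(\mathbf{R}^d)\to\mathbf{R}$ with gradient $\mathcal{G}_{\mathcal{F}}$ is transport $L$-smooth if $\mathcal{F}(T_\#\mu)-\mathcal{F}(S_\#\mu)\le\int\langle\mathcal{G}_{\mathcal{F}}[S_\#\mu](S(x)),T(x)-S(x)\rangle\,\mathrm{d}\mu(x)+\frac L2\int\|T(x)-S(x)\|^2\,\mathrm{d}\mu(x)$ for any $S,T\in L^2(\mathbf{R}^d\to\mathbf{R}^d)$ and $\mu\in\mathcal{P}_2(\mathbf{R}^d)$. *)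

theory Defs
  imports "HOL-Probability.Probability"
begin

definition P2 :: "(real^'n) measure set" where
  "P2 = {\<mu>. prob_space \<mu> \<and> sets \<mu> = sets borel \<and> integrable \<mu> (\<lambda>x. (norm x)\<^sup>2)}"

text \<open>Maps are taken as Borel representatives; nothing below depends on their values on
  \<open>\<mu>\<close>-null sets.\<close>

definition L2_maps :: "(real^'n) measure \<Rightarrow> (real^'n \<Rightarrow> real^'n) set" where
  "L2_maps \<mu> = {T. T \<in> borel_measurable \<mu> \<and> integrable \<mu> (\<lambda>x. (norm (T x))\<^sup>2)}"

definition transport_smooth ::
  "real \<Rightarrow> ((real^'n) measure \<Rightarrow> real) \<Rightarrow> ((real^'n) measure \<Rightarrow> real^'n \<Rightarrow> real^'n) \<Rightarrow> bool" where
  "transport_smooth L F G \<longleftrightarrow>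
    (\<forall>\<mu>\<in>P2. \<forall>S\<in>L2_maps \<mu>. \<forall>T\<in>L2_maps \<mu>.
      F (distr \<mu> borel T) - F (distr \<mu> borel S)
        \<le> (\<integral>x. G (distr \<mu> borel S) (S x) \<bullet> (T x - S x) \<partial>\<mu>)
          + L / 2 * (\<integral>x. (norm (T x - S x))\<^sup>2 \<partial>\<mu>))"

definition C2 :: "('a::real_normed_vector \<Rightarrow> real) \<Rightarrow> bool" where
  "C2 f \<longleftrightarrow>
    (\<exists>(f' :: 'a \<Rightarrow> 'a \<Rightarrow>\<^sub>L real) (f'' :: 'a \<Rightarrow> 'a \<Rightarrow>\<^sub>L 'a \<Rightarrow>\<^sub>L real).
      (\<forall>z. (f has_derivative blinfun_apply (f' z)) (at z)) \<and>
      (\<forall>z. (f' has_derivative blinfun_apply (f'' z)) (at z)) \<and>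
      continuous_on UNIV f'')"

text \<open>The gradient is meaningful only where \<open>f\<close> is differentiable.\<close>

definition grad :: "(real^'n \<Rightarrow> real) \<Rightarrow> real^'n \<Rightarrow> real^'n" where
  "grad f x = (THE D. GDERIV f x :> D)"

definition grad1 :: "(real^'n \<Rightarrow> real^'n \<Rightarrow> real) \<Rightarrow> real^'n \<Rightarrow> real^'n \<Rightarrow> real^'n" where
  "grad1 W x y = grad (\<lambda>x'. W x' y) x"

definition grad2 :: "(real^'n \<Rightarrow> real^'n \<Rightarrow> real) \<Rightarrow> real^'n \<Rightarrow> real^'n \<Rightarrow> real^'n" where
  "grad2 W x y = grad (\<lambda>y'. W x y') y"

text \<open>The index type \<open>'n + 'n\<close> numbers the \<open>2 d\<close> coordinates of \<open>(x, y)\<close>: \<open>Inl i\<close> stands for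
  \<open>x\<^sub>i\<close> and \<open>Inr i\<close> for \<open>y\<^sub>i\<close>.  The \<open>(i, j)\<close> entry of the block \<open>\<nabla>\<^sub>a \<nabla>\<^sub>b W\<close> differentiates
  with respect to the \<open>j\<close>-th coordinate of the \<open>b\<close>-th variable first.\<close>

definition hessian ::
  "(real^'n \<Rightarrow> real^'n \<Rightarrow> real) \<Rightarrow> real^'n \<Rightarrow> real^'n \<Rightarrow> real^('n + 'n)^('n + 'n)" where
  "hessian W x y = (\<chi> a b.
    (case a of
      Inl i \<Rightarrow> (case b of
          Inl j \<Rightarrow> grad1 (\<lambda>u v. grad1 W u v $ j) x y $ i
        | Inr j \<Rightarrow> grad1 (\<lambda>u v. grad2 W u v $ j) x y $ i)
    | Inr i \<Rightarrow> (case b of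
          Inl j \<Rightarrow> grad2 (\<lambda>u v. grad1 W u v $ j) x y $ i
        | Inr j \<Rightarrow> grad2 (\<lambda>u v. grad2 W u v $ j) x y $ i)))"

definition complex_eigenvalues :: "real^'m^'m \<Rightarrow> complex set" where
  "complex_eigenvalues A =
    {c. \<exists>v::complex^'m. v \<noteq> 0 \<and> (\<chi> i j. complex_of_real (A $ i $ j)) *v v = c *s v}"

text \<open>The set of eigenvalues is finite and nonempty, so the supremum is a maximum.\<close>

definition spectral_radius :: "real^'m^'m \<Rightarrow> real" where
  "spectral_radius A = (SUP c\<in>complex_eigenvalues A. cmod c)"

text \<open>The integrals are Bochner integrals, which are \<open>0\<close> for functions that are not integrable.
  If the Hessian of \<open>W\<close> is bounded and \<open>\<mu>\<close> is in \<open>P2\<close>, then \<open>W\<close> grows at most quadratically and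
  its gradient at most linearly, so the functions below are integrable.\<close>

definition interaction_energy ::
  "(real^'n \<Rightarrow> real^'n \<Rightarrow> real) \<Rightarrow> (real^'n) measure \<Rightarrow> real" where
  "interaction_energy W \<mu> = 1 / 2 * (\<integral>y. (\<integral>x. W x y \<partial>\<mu>) \<partial>\<mu>)"

definition interaction_gradient ::
  "(real^'n \<Rightarrow> real^'n \<Rightarrow> real) \<Rightarrow> (real^'n) measure \<Rightarrow> real^'n \<Rightarrow> real^'n" where
  "interaction_gradient W \<mu> x = (\<integral>y. grad1 W x y \<partial>\<mu>)"

end

theory Submission
  imports Defs
begin

text \<open>
  The second derivative of \<open>W\<close> is symmetric, so the operator norm of the Hessian equals its
  spectral radius and the derivative of \<open>W\<close> is \<open>L\<close>-Lipschitz with \<open>L = r\<^sub>W\<close>.  The descent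
  inequality for \<open>W\<close> between \<open>(S x, S y)\<close> and \<open>(T x, T y)\<close> is then integrated over
  \<open>\<mu> \<otimes> \<mu>\<close>.  By the symmetry of \<open>W\<close> both first-order terms have the same integral, which
  cancels the factor \<open>1 / 2\<close> of the energy.
\<close>

section \<open>Symmetry of second derivatives\<close>

text \<open>The second difference of \<open>f\<close> over the parallelogram spanned by
  \<open>s *\<^sub>R u\<close> and \<open>s *\<^sub>R v\<close> ignores the order of
  \<open>u\<close> and \<open>v\<close>. Comparing its leading terms for both orders as
  \<open>s\<close> tends to 0 gives the claim.\<close>

lemma second_derivative_symmetric:
  fixes f :: "'a::real_normed_vector \<Rightarrow> real" and f' :: "'a \<Rightarrow> 'a \<Rightarrow>\<^sub>L real"
    and D :: "'a \<Rightarrow>\<^sub>L 'a \<Rightarrow>\<^sub>L real"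
  assumes f: "\<And>x. (f has_derivative f' x) (at x)"
    and f': "(f' has_derivative D) (at z)"
  shows "D u v = D v u"
proof -
  define \<Delta> where "\<Delta> s u v = f (z + s *\<^sub>R u + s *\<^sub>R v) - f (z + s *\<^sub>R u) - f (z + s *\<^sub>R v) + f z"
    for s :: real and u v
  \<comment> \<open>Asymptotically \<open>\<Delta> s u v\<close>, which is symmetric in \<open>u\<close> and \<open>v\<close>, is \<open>s\<^sup>2 * D v u\<close>.\<close>
  have approx: "\<exists>\<delta>>0. \<forall>s. 0 < s \<and> s < \<delta> \<longrightarrow>
      \<bar>\<Delta> s u v - s\<^sup>2 * D v u\<bar> \<le> s\<^sup>2 * (e * (2 * norm u + norm v) * norm u)"
    if "e > 0" for e u v
  proof -
    obtain d where "d > 0" and d: "\<And>y. norm (y - z) < d \<Longrightarrow>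
        norm (f' y - f' z - D (y - z)) \<le> e * norm (y - z)"
      using f' \<open>e > 0\<close> unfolding has_derivative_at_alt by blast
    \<comment> \<open>For \<open>s < \<delta>\<close> all points involved stay within distance
      \<open>d\<close> of \<open>z\<close>, where the linearization of \<open>f'\<close> is
      accurate. The summand 1 covers \<open>u = v = 0\<close>.\<close>
    define \<delta> where "\<delta> = d / (norm u + norm v + 1)"
    have pos: "norm u + norm v + 1 > 0"
      by (smt (verit) norm_ge_zero)
    have "\<delta> > 0"
      unfolding \<delta>_def using \<open>d > 0\<close> pos by simp
    moreover have "\<bar>\<Delta> s u v - s\<^sup>2 * D v u\<bar> \<le> s\<^sup>2 * (e * (2 * norm u + norm v) * norm u)"
      if s: "0 < s" "s < \<delta>" for s
    proof -
      \<comment> \<open>The increment of \<open>\<phi>\<close> over \<open>[0, s]\<close> is exactly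
        the error to be estimated, so a bound on \<open>\<phi>'\<close> suffices.\<close>
      define \<phi> where "\<phi> t = f (z + t *\<^sub>R u + s *\<^sub>R v) - f (z + t *\<^sub>R u) - t * (s * D v u)" for t
      define \<phi>' where "\<phi>' t = (f' (z + t *\<^sub>R u + s *\<^sub>R v) u - f' (z + t *\<^sub>R u) u) - s * D v u" for t
      have der: "(\<phi> has_real_derivative \<phi>' t) (at t)" for t
        unfolding \<phi>_def \<phi>'_def has_field_derivative_def
        by (auto intro!: derivative_eq_intros has_derivative_compose[OF _ f] ext
            simp: blinfun.scaleR_right algebra_simps)
      have bound: "\<bar>\<phi>' t\<bar> \<le> s * (e * (2 * norm u + norm v) * norm u)" if t: "0 \<le> t" "t \<le> s" for t
      proof -
        have "s * (norm u + norm v + 1) < d"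
          using s(2) pos by (simp add: \<delta>_def pos_less_divide_eq)
        moreover have "s * (norm u + norm v) \<le> s * (norm u + norm v + 1)"
          using s(1) by simp
        ultimately have sd: "s * (norm u + norm v) < d" by linarith
        have tu: "norm (t *\<^sub>R u) \<le> s * norm u"
          using t by (simp add: mult_right_mono)
        have tuv: "norm (t *\<^sub>R u + s *\<^sub>R v) \<le> s * (norm u + norm v)"
          using norm_triangle_ineq[of "t *\<^sub>R u" "s *\<^sub>R v"] tu s by (simp add: algebra_simps)
        have tu': "norm (t *\<^sub>R u) \<le> s * (norm u + norm v)"
          using tu s by (simp add: algebra_simps add_increasing2)
        \<comment> \<open>Remainder of the linearization of \<open>f'\<close> at \<open>z\<close>.
          In the difference of two remainders the terms \<open>t *\<^sub>R D u\<close> cancel and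
          only \<open>s *\<^sub>R D v\<close> is left, which \<open>\<phi>'\<close>
          subtracts.\<close>
        define R where "R h = f' (z + h) - f' z - D h" for h
        have R: "norm (R h) \<le> e * norm h" if "norm h < d" for h
          using d[of "z + h"] that by (simp add: R_def)
        have "R (t *\<^sub>R u + s *\<^sub>R v) - R (t *\<^sub>R u)
            = f' (z + t *\<^sub>R u + s *\<^sub>R v) - f' (z + t *\<^sub>R u) - s *\<^sub>R D v"
          by (simp add: R_def blinfun.add_right blinfun.scaleR_right algebra_simps)
        then have "\<phi>' t = (R (t *\<^sub>R u + s *\<^sub>R v) - R (t *\<^sub>R u)) u"
          by (simp add: \<phi>'_def blinfun.diff_left blinfun.scaleR_left)
        also have "\<bar>\<dots>\<bar> \<le> norm (R (t *\<^sub>R u + s *\<^sub>R v) - R (t *\<^sub>R u)) * norm u"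
          using norm_blinfun[of "R (t *\<^sub>R u + s *\<^sub>R v) - R (t *\<^sub>R u)" u] by simp
        also have "\<dots> \<le> (e * (s * (norm u + norm v)) + e * (s * norm u)) * norm u"
        proof (intro mult_right_mono order_trans[OF norm_triangle_ineq4] add_mono)
          show "norm (R (t *\<^sub>R u + s *\<^sub>R v)) \<le> e * (s * (norm u + norm v))"
            using R[of "t *\<^sub>R u + s *\<^sub>R v"] tuv sd \<open>e > 0\<close>
            by (smt (verit) mult_left_mono)
          show "norm (R (t *\<^sub>R u)) \<le> e * (s * norm u)"
            using R[of "t *\<^sub>R u"] tu tu' sd \<open>e > 0\<close>
            by (smt (verit) mult_left_mono)
        qed simp
        finally show ?thesis by (simp add: algebra_simps)
      qed
      have "norm (\<phi> s - \<phi> 0) \<le> s * (e * (2 * norm u + norm v) * norm u) * norm (s - 0)"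
        by (rule field_differentiable_bound[of "{0..s}" \<phi> \<phi>'])
          (use der bound s in \<open>auto intro: DERIV_subset\<close>)
      moreover have "\<phi> s - \<phi> 0 = \<Delta> s u v - s\<^sup>2 * D v u"
        by (simp add: \<phi>_def \<Delta>_def power2_eq_square)
      ultimately show ?thesis
        using s by (simp add: power2_eq_square algebra_simps)
    qed
    ultimately show ?thesis by blast
  qed
  define C where "C = (2 * norm u + norm v) * norm u + (2 * norm v + norm u) * norm v"
  have "C \<ge> 0" by (simp add: C_def)
  have small: "\<bar>D u v - D v u\<bar> \<le> e * C" if "e > 0" for e
  proof -
    obtain \<delta>1 \<delta>2 where "\<delta>1 > 0" "\<delta>2 > 0"
      and 1: "\<And>s. 0 < s \<Longrightarrow> s < \<delta>1 \<Longrightarrow>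
        \<bar>\<Delta> s u v - s\<^sup>2 * D v u\<bar> \<le> s\<^sup>2 * (e * (2 * norm u + norm v) * norm u)"
      and 2: "\<And>s. 0 < s \<Longrightarrow> s < \<delta>2 \<Longrightarrow>
        \<bar>\<Delta> s v u - s\<^sup>2 * D u v\<bar> \<le> s\<^sup>2 * (e * (2 * norm v + norm u) * norm v)"
      using approx[OF \<open>e > 0\<close>, of u v] approx[OF \<open>e > 0\<close>, of v u] by blast
    define s where "s = min \<delta>1 \<delta>2 / 2"
    have s: "0 < s" "s < \<delta>1" "s < \<delta>2"
      using \<open>\<delta>1 > 0\<close> \<open>\<delta>2 > 0\<close> by (auto simp: s_def min_def)
    have "\<Delta> s v u = \<Delta> s u v"
      by (simp add: \<Delta>_def algebra_simps)
    then have "\<bar>s\<^sup>2 * D u v - s\<^sup>2 * D v u\<bar> \<le> s\<^sup>2 * (e * C)"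
      using 1[OF s(1,2)] 2[OF s(1,3)] by (simp add: C_def algebra_simps)
    then have "s\<^sup>2 * \<bar>D u v - D v u\<bar> \<le> s\<^sup>2 * (e * C)"
      by (simp flip: right_diff_distrib add: abs_mult)
    then show ?thesis
      using s(1) by simp
  qed
  \<comment> \<open>Rescaling \<open>e\<close> by \<open>C + 1\<close> rather than \<open>C\<close>
    avoids a division by zero.\<close>
  have "\<bar>D u v - D v u\<bar> \<le> 0 + e" if "e > 0" for e
  proof -
    have "\<bar>D u v - D v u\<bar> \<le> e / (C + 1) * C"
      using small[of "e / (C + 1)"] that \<open>C \<ge> 0\<close> by simp
    also have "\<dots> \<le> e"
      using that \<open>C \<ge> 0\<close> by (simp add: field_simps)
    finally show ?thesis by simp
  qed
  then have "\<bar>D u v - D v u\<bar> \<le> 0"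
    by (rule field_le_epsilon)
  then show ?thesis by simp
qed

section \<open>Spectral radius and operator norm of symmetric matrices\<close>

lemma real_eigenvalue_in_complex_eigenvalues:
  fixes A :: "real^'m^'m"
  assumes "A *v v = c *\<^sub>R v" "v \<noteq> 0"
  shows "of_real c \<in> complex_eigenvalues A"
proof -
  define u :: "complex^'m" where "u = (\<chi> i. of_real (v $ i))"
  have "u \<noteq> 0"
    using assms(2) by (simp add: u_def vec_eq_iff)
  moreover have "(\<chi> i j. complex_of_real (A $ i $ j)) *v u = of_real c *s u"
  proof -
    have "(\<Sum>j\<in>UNIV. A $ i $ j * v $ j) = c * v $ i" for i
      using arg_cong[OF assms(1), of "\<lambda>x. x $ i"] by (simp add: matrix_vector_mult_def)
    then show ?thesis
      by (simp add: vec_eq_iff matrix_vector_mult_def u_def flip: of_real_mult of_real_sum)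
  qed
  ultimately show ?thesis
    unfolding complex_eigenvalues_def by blast
qed

text \<open>Needed for the supremum in \<open>spectral_radius\<close> to be an upper bound. As in
  Gershgorin's argument, the eigenvalue equation is read at a coordinate of largest modulus; summing
  over all rows makes the bound independent of that coordinate.\<close>

lemma bdd_above_complex_eigenvalues:
  fixes A :: "real^'m^'m"
  shows "bdd_above (cmod ` complex_eigenvalues A)"
proof (rule bdd_aboveI2)
  fix c assume "c \<in> complex_eigenvalues A"
  then obtain v :: "complex^'m" where "v \<noteq> 0"
    and v: "(\<chi> i j. complex_of_real (A $ i $ j)) *v v = c *s v"
    unfolding complex_eigenvalues_def by blast
  define K where "K = (\<Sum>i\<in>UNIV. \<Sum>j\<in>UNIV. \<bar>A $ i $ j\<bar>)"
  obtain i where i: "\<And>j. cmod (v $ j) \<le> cmod (v $ i)"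
  proof -
    have "finite (range (\<lambda>j. cmod (v $ j)))" by simp
    moreover from this obtain i where "cmod (v $ i) = Max (range (\<lambda>j. cmod (v $ j)))"
      using Max_in[of "range (\<lambda>j. cmod (v $ j))"] by fastforce
    ultimately show ?thesis
      using that[of i] by simp
  qed
  have "v $ i \<noteq> 0"
    using i \<open>v \<noteq> 0\<close> by (metis norm_le_zero_iff norm_zero vec_eq_iff zero_index)
  have "c * v $ i = (\<Sum>j\<in>UNIV. of_real (A $ i $ j) * v $ j)"
    using arg_cong[OF v, of "\<lambda>x. x $ i"] by (simp add: matrix_vector_mult_def)
  then have "cmod c * cmod (v $ i) = cmod (\<Sum>j\<in>UNIV. of_real (A $ i $ j) * v $ j)"
    by (metis norm_mult)
  also have "\<dots> \<le> (\<Sum>j\<in>UNIV. \<bar>A $ i $ j\<bar> * cmod (v $ i))"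
    by (rule sum_norm_le) (simp add: norm_mult i mult_left_mono)
  also have "\<dots> \<le> K * cmod (v $ i)"
    unfolding K_def sum_distrib_right[symmetric]
    by (intro mult_right_mono member_le_sum[of i]) (auto intro: sum_nonneg)
  finally show "cmod c \<le> (\<Sum>i\<in>UNIV. \<Sum>j\<in>UNIV. \<bar>A $ i $ j\<bar>)"
    using \<open>v $ i \<noteq> 0\<close> by (simp add: K_def)
qed

text \<open>By compactness the operator norm \<open>m\<close> is attained at a unit vector
  \<open>v\<close>. Symmetry makes \<open>v\<close> an eigenvector of the square of \<open>A\<close>
  for \<open>m^2\<close>, and hence \<open>m\<close> or \<open>- m\<close> an eigenvalue of
  \<open>A\<close>.\<close>

lemma norm_symmetric_matrix_le_spectral_radius:
  fixes A :: "real^'m^'m"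
  assumes sym: "transpose A = A"
  shows "norm (A *v x) \<le> spectral_radius A * norm x"
proof -
  have adj: "(A *v x) \<bullet> y = x \<bullet> (A *v y)" for x y
    by (metis dot_lmul_matrix sym transpose_matrix_vector)
  have "compact (sphere 0 1 :: (real^'m) set)" "sphere 0 1 \<noteq> ({} :: (real^'m) set)"
    by auto
  moreover have "continuous_on (sphere 0 1) (\<lambda>x. norm (A *v x))"
    by (intro continuous_intros)
  ultimately obtain v where v: "norm v = 1" and max: "\<And>x. norm x = 1 \<Longrightarrow> norm (A *v x) \<le> norm (A *v v)"
    using continuous_attains_sup[of "sphere 0 1" "\<lambda>x. norm (A *v x)"] by (auto simp: dist_norm)
  define m where "m = norm (A *v v)"
  have m: "norm (A *v x) \<le> m * norm x" for x
  proof (cases "x = 0")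
    case False
    then have "norm (A *v (x /\<^sub>R norm x)) \<le> m"
      unfolding m_def by (intro max) simp
    then show ?thesis
      using False by (simp add: matrix_vector_mult_scaleR field_simps)
  qed simp
  \<comment> \<open>Equality case of Cauchy-Schwarz: \<open>w\<close> has norm at most
    \<open>m^2\<close>, and its inner product with the unit vector \<open>v\<close> is
    \<open>m^2\<close>, so expanding the square of \<open>norm (w - m^2 v)\<close> leaves at most
    0.\<close>
  define w where "w = A *v (A *v v)"
  have "norm w \<le> m\<^sup>2"
    using m[of "A *v v"] by (simp add: w_def m_def power2_eq_square)
  then have "(norm w)\<^sup>2 \<le> (m\<^sup>2)\<^sup>2"
    by (rule power_mono) simp
  moreover have "w \<bullet> v = m\<^sup>2"
    by (simp add: w_def m_def adj power2_norm_eq_inner)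
  moreover have "(norm (w - m\<^sup>2 *\<^sub>R v))\<^sup>2 = (norm w)\<^sup>2 - 2 * m\<^sup>2 * (w \<bullet> v) + (m\<^sup>2)\<^sup>2 * (norm v)\<^sup>2"
    unfolding power2_norm_eq_inner
    by (simp add: inner_diff inner_commute power2_eq_square algebra_simps)
  ultimately have "(norm (w - m\<^sup>2 *\<^sub>R v))\<^sup>2 \<le> 0"
    using v by (simp add: power2_eq_square)
  then have w: "A *v (A *v v) = m\<^sup>2 *\<^sub>R v"
    by (simp add: w_def)
  \<comment> \<open>Since \<open>(A - m) (A + m) v = 0\<close>, one of \<open>- m\<close> and \<open>m\<close> is an eigenvalue.\<close>
  have "\<exists>c\<in>complex_eigenvalues A. cmod c = m"
  proof (cases "A *v v + m *\<^sub>R v = 0")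
    case True
    then have "A *v v = (- m) *\<^sub>R v"
      by (simp add: add_eq_0_iff)
    then have "of_real (- m) \<in> complex_eigenvalues A"
      using v by (intro real_eigenvalue_in_complex_eigenvalues) auto
    then show ?thesis
      by (rule bexI[rotated]) (simp add: m_def)
  next
    case False
    have "A *v (A *v v + m *\<^sub>R v) = m *\<^sub>R (A *v v + m *\<^sub>R v)"
      by (simp add: matrix_vector_right_distrib matrix_vector_mult_scaleR w power2_eq_square algebra_simps)
    then have "of_real m \<in> complex_eigenvalues A"
      using False by (rule real_eigenvalue_in_complex_eigenvalues)
    then show ?thesis
      by (rule bexI[rotated]) (simp add: m_def)
  qed
  then have "m \<le> spectral_radius A"
    unfolding spectral_radius_def by (metis cSUP_upper bdd_above_complex_eigenvalues)
  then show ?thesis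
    using m[of x] by (meson mult_right_mono norm_ge_zero order_trans)
qed

section \<open>Quadratic bounds from a Lipschitz derivative\<close>

text \<open>Along the segment, \<open>g\<close> subtracts from \<open>f\<close> the linear and
  quadratic terms of the bound; the Lipschitz condition makes its derivative nonpositive on
  \<open>[0, 1]\<close>.\<close>

lemma descent_inequality:
  fixes f :: "'a::real_normed_vector \<Rightarrow> real" and f' :: "'a \<Rightarrow> 'a \<Rightarrow>\<^sub>L real"
  assumes f: "\<And>x. (f has_derivative f' x) (at x)"
    and lip: "\<And>x y. norm (f' x - f' y) \<le> L * norm (x - y)"
  shows "f (x + h) \<le> f x + f' x h + L / 2 * (norm h)\<^sup>2"
proof -
  define g where "g t = f (x + t *\<^sub>R h) - t * f' x h - L / 2 * t\<^sup>2 * (norm h)\<^sup>2" for t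
  have "g 1 \<le> g 0"
  proof (rule DERIV_nonpos_imp_nonincreasing[of 0 1 g])
    fix t :: real assume t: "0 \<le> t" "t \<le> 1"
    have "(g has_real_derivative (f' (x + t *\<^sub>R h) h - f' x h - L * t * (norm h)\<^sup>2)) (at t)"
      unfolding g_def has_field_derivative_def
      by (auto intro!: derivative_eq_intros has_derivative_compose[OF _ f]
          simp: blinfun.scaleR_right algebra_simps)
    moreover have "(f' (x + t *\<^sub>R h) - f' x) h \<le> L * t * (norm h)\<^sup>2"
    proof -
      have "(f' (x + t *\<^sub>R h) - f' x) h \<le> norm (f' (x + t *\<^sub>R h) - f' x) * norm h"
        using norm_blinfun[of "f' (x + t *\<^sub>R h) - f' x" h] by simp
      also have "\<dots> \<le> (L * norm (t *\<^sub>R h)) * norm h"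
        using lip[of "x + t *\<^sub>R h" x] by (intro mult_right_mono) auto
      finally show ?thesis
        using t by (simp add: power2_eq_square algebra_simps)
    qed
    ultimately show "\<exists>y. (g has_real_derivative y) (at t) \<and> y \<le> 0"
      by (auto simp: blinfun.diff_left)
  qed simp
  then show ?thesis
    by (simp add: g_def)
qed

text \<open>The descent inequality for \<open>f\<close> and for \<open>- f\<close>. The upper half
  yields smoothness; both halves together control the growth of \<open>W\<close>, hence
  integrability.\<close>

lemma lipschitz_derivative_taylor_bound:
  fixes f :: "'a::real_normed_vector \<Rightarrow> real" and f' :: "'a \<Rightarrow> 'a \<Rightarrow>\<^sub>L real"
  assumes f: "\<And>x. (f has_derivative f' x) (at x)"
    and lip: "\<And>x y. norm (f' x - f' y) \<le> L * norm (x - y)"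
  shows "\<bar>f y - f x - f' x (y - x)\<bar> \<le> L / 2 * (norm (y - x))\<^sup>2"
proof -
  have "- f (x + (y - x)) \<le> - f x + (- f' x) (y - x) + L / 2 * (norm (y - x))\<^sup>2"
  proof (rule descent_inequality[where f' = "\<lambda>x. - f' x"])
    show "((\<lambda>x. - f x) has_derivative (- f' x)) (at x)" for x
      by (auto intro!: derivative_eq_intros f simp: blinfun.minus_left)
    show "norm (- f' x - - f' y) \<le> L * norm (x - y)" for x y
      using lip[of y x] by (simp add: norm_minus_commute)
  qed
  then have "- (f y - f x - f' x (y - x)) \<le> L / 2 * (norm (y - x))\<^sup>2"
    by (simp add: blinfun.minus_left)
  moreover have "f y - f x - f' x (y - x) \<le> L / 2 * (norm (y - x))\<^sup>2"
    using descent_inequality[OF f lip, of x "y - x"] by simp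
  ultimately show ?thesis
    by (intro abs_leI)
qed

section \<open>Gradients and the Hessian in coordinates\<close>

text \<open>As \<open>grad\<close> is a definite description, existence and uniqueness are both
  required: the Riesz vector \<open>adjoint F 1\<close> represents \<open>F\<close>, and derivatives
  are unique.\<close>

lemma inner_grad:
  assumes "(f has_derivative F) (at x)"
  shows "h \<bullet> grad f x = F h"
proof -
  have lin: "linear F"
    using assms by (rule has_derivative_linear)
  have F: "F h = h \<bullet> adjoint F 1" for h
    using adjoint_works[OF lin, of h 1] by simp
  have "GDERIV f x :> adjoint F 1"
    using assms unfolding gderiv_def by (simp add: F[abs_def, symmetric])
  moreover have "D = adjoint F 1" if "GDERIV f x :> D" for D
  proof -
    have "(\<lambda>h. h \<bullet> D) = F"
      using that assms unfolding gderiv_def by (rule has_derivative_unique)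
    then have "h \<bullet> D = h \<bullet> adjoint F 1" for h
      by (metis F)
    then show ?thesis
      using vector_eq_ldot by blast
  qed
  ultimately have "grad f x = adjoint F 1"
    unfolding grad_def by (rule the_equality)
  then show ?thesis
    by (simp add: F)
qed

lemma inner_grad1:
  assumes "((\<lambda>(x, y). W x y) has_derivative F) (at (x, y))"
  shows "h \<bullet> grad1 W x y = F (h, 0)"
proof -
  have "((\<lambda>x'. (case (x', y) of (x, y) \<Rightarrow> W x y)) has_derivative (\<lambda>h. F (h, 0))) (at x)"
    by (rule has_derivative_compose[where f = "\<lambda>x'. (x', y)" and g = "\<lambda>(x, y). W x y", OF _ assms]) (auto intro!: derivative_eq_intros)
  then show ?thesis
    unfolding grad1_def by (intro inner_grad) simp
qed

lemma inner_grad2: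
  assumes "((\<lambda>(x, y). W x y) has_derivative F) (at (x, y))"
  shows "h \<bullet> grad2 W x y = F (0, h)"
proof -
  have "((\<lambda>y'. (case (x, y') of (x, y) \<Rightarrow> W x y)) has_derivative (\<lambda>h. F (0, h))) (at y)"
    by (rule has_derivative_compose[where f = "\<lambda>y'. (x, y')" and g = "\<lambda>(x, y). W x y", OF _ assms]) (auto intro!: derivative_eq_intros)
  then show ?thesis
    unfolding grad2_def by (intro inner_grad) simp
qed

text \<open>The standard basis of the product space, indexed like the rows and columns of
  \<open>hessian\<close>.\<close>

definition pair_axis :: "'n + 'n \<Rightarrow> (real^'n) \<times> (real^'n)" where
  "pair_axis a = (case a of Inl i \<Rightarrow> (axis i 1, 0) | Inr i \<Rightarrow> (0, axis i 1))"

text \<open>The isometry from the product space, where \<open>f''\<close> acts, to the coordinate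
  space, where the matrix \<open>hessian\<close> acts. It lets norm bounds pass from one to the
  other.\<close>

definition pair_coords :: "(real^'n) \<times> (real^'n) \<Rightarrow> real^('n + 'n)" where
  "pair_coords z = (\<chi> a. case a of Inl i \<Rightarrow> fst z $ i | Inr i \<Rightarrow> snd z $ i)"

lemma sum_UNIV_Plus:
  "(\<Sum>a\<in>(UNIV :: ('a::finite + 'b::finite) set). g a) = (\<Sum>i\<in>UNIV. g (Inl i)) + (\<Sum>i\<in>UNIV. g (Inr i))"
  by (simp add: sum.Plus flip: UNIV_Plus_UNIV)

lemma norm_pair_coords: "norm (pair_coords z) = norm z"
proof -
  have "(norm (pair_coords z))\<^sup>2 = (norm z)\<^sup>2"
    by (cases z) (simp only: power2_norm_eq_inner inner_vec_def inner_Pair sum_UNIV_Plus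
        pair_coords_def vec_lambda_beta sum.case fst_conv snd_conv)
  then show ?thesis by simp
qed

lemma pair_coords_expansion: "z = (\<Sum>a\<in>UNIV. pair_coords z $ a *\<^sub>R pair_axis a)"
proof (rule prod_eqI)
  have "x = (\<Sum>i\<in>UNIV. x $ i *\<^sub>R axis i 1)" for x :: "real^'a"
    using basis_expansion[of x] by (simp add: scalar_mult_eq_scaleR)
  then show "fst z = fst (\<Sum>a\<in>UNIV. pair_coords z $ a *\<^sub>R pair_axis a)"
    and "snd z = snd (\<Sum>a\<in>UNIV. pair_coords z $ a *\<^sub>R pair_axis a)"
    by (simp_all add: fst_sum snd_sum sum_UNIV_Plus pair_coords_def pair_axis_def)
qed

context
  fixes W :: "real^'n \<Rightarrow> real^'n \<Rightarrow> real"
    and f' :: "(real^'n) \<times> (real^'n) \<Rightarrow> ((real^'n) \<times> (real^'n)) \<Rightarrow>\<^sub>L real"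
    and f'' :: "(real^'n) \<times> (real^'n) \<Rightarrow> ((real^'n) \<times> (real^'n)) \<Rightarrow>\<^sub>L ((real^'n) \<times> (real^'n)) \<Rightarrow>\<^sub>L real"
  assumes f': "\<And>z. ((\<lambda>(x, y). W x y) has_derivative f' z) (at z)"
    and f'': "\<And>z. (f' has_derivative f'' z) (at z)"
begin

text \<open>The gradient taken first, along \<open>b\<close>, evaluates \<open>f'\<close> at
  \<open>pair_axis b\<close>, which becomes the last argument of \<open>f''\<close>; the later one,
  along \<open>a\<close>, supplies the direction in which \<open>f'\<close> is
  differentiated.\<close>

lemma hessian_eq_second_derivative:
  "hessian W x y $ a $ b = f'' (x, y) (pair_axis a) (pair_axis b)"
proof -
  have g1: "grad1 W u v $ j = f' (u, v) (axis j 1, 0)"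
    and g2: "grad2 W u v $ j = f' (u, v) (0, axis j 1)" for u v j
    using inner_grad1[OF f', of "axis j 1" u v] inner_grad2[OF f', of "axis j 1" u v]
    by (simp_all add: inner_axis')
  have d: "((\<lambda>(u, v). f' (u, v) e) has_derivative (\<lambda>h. f'' (x, y) h e)) (at (x, y))" for e
    using bounded_linear.has_derivative[OF blinfun.bounded_linear_left f''[of "(x, y)"], of e]
    by (simp add: case_prod_beta')
  have "grad1 (\<lambda>u v. f' (u, v) e) x y $ i = f'' (x, y) (axis i 1, 0) e"
    and "grad2 (\<lambda>u v. f' (u, v) e) x y $ i = f'' (x, y) (0, axis i 1) e" for e i
    using inner_grad1[OF d, of "axis i 1" e] inner_grad2[OF d, of "axis i 1" e]
    by (simp_all add: inner_axis')
  then show ?thesis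
    by (simp add: hessian_def pair_axis_def g1 g2 split: sum.split)
qed

lemma second_derivative_eq_hessian:
  "f'' (x, y) z w = pair_coords z \<bullet> (hessian W x y *v pair_coords w)"
proof -
  have "f'' (x, y) z w =
      f'' (x, y) (\<Sum>a\<in>UNIV. pair_coords z $ a *\<^sub>R pair_axis a) (\<Sum>a\<in>UNIV. pair_coords w $ a *\<^sub>R pair_axis a)"
    by (simp flip: pair_coords_expansion)
  also have "\<dots> = (\<Sum>a\<in>UNIV. pair_coords z $ a *
      (\<Sum>b\<in>UNIV. f'' (x, y) (pair_axis a) (pair_axis b) * pair_coords w $ b))"
    by (simp add: blinfun.sum_right blinfun.sum_left blinfun.scaleR_right blinfun.scaleR_left
        mult.commute sum_distrib_left sum_distrib_right mult.left_commute) (rule sum.swap)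
  finally show ?thesis
    by (simp add: inner_vec_def matrix_vector_mult_def hessian_eq_second_derivative)
qed

lemma transpose_hessian: "transpose (hessian W x y) = hessian W x y"
  by (simp add: vec_eq_iff transpose_def hessian_eq_second_derivative
      second_derivative_symmetric[OF f' f''])

text \<open>Cauchy-Schwarz for the bilinear form of the Hessian, combined with the bound for
  symmetric matrices.\<close>

lemma norm_second_derivative_le:
  "norm (f'' (x, y)) \<le> spectral_radius (hessian W x y)"
proof -
  let ?r = "spectral_radius (hessian W x y)"
  \<comment> \<open>Any unit vector would do: the norm bound at it shows that the radius is
    nonnegative.\<close>
  have "0 \<le> ?r * norm (axis undefined 1 :: real^('n + 'n))"
    using norm_symmetric_matrix_le_spectral_radius[OF transpose_hessian] norm_ge_zero order_trans
    by blast
  then have "0 \<le> ?r" by simp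
  have "norm (f'' (x, y) z w) \<le> ?r * norm z * norm w" for z w
  proof -
    have "norm (f'' (x, y) z w) \<le> norm z * norm (hessian W x y *v pair_coords w)"
      unfolding second_derivative_eq_hessian
      using Cauchy_Schwarz_ineq2[of "pair_coords z"] by (simp add: norm_pair_coords)
    also have "\<dots> \<le> norm z * (?r * norm w)"
      using norm_symmetric_matrix_le_spectral_radius[OF transpose_hessian, of x y "pair_coords w"]
      by (intro mult_left_mono) (auto simp: norm_pair_coords)
    finally show ?thesis by (simp add: algebra_simps)
  qed
  then show ?thesis
    using \<open>0 \<le> ?r\<close> by (intro norm_blinfun_bound) auto
qed

lemma lipschitz_derivative:
  assumes "\<And>x y. spectral_radius (hessian W x y) \<le> L"
  shows "norm (f' z - f' w) \<le> L * norm (z - w)"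
proof (rule differentiable_bound[of UNIV])
  show "onorm (f'' z) \<le> L" for z
    using norm_second_derivative_le[of "fst z" "snd z"] assms[of "fst z" "snd z"]
    by (simp add: norm_blinfun.rep_eq)
qed (auto intro: f'')

end

section \<open>Integration of the pointwise inequality over the product measure\<close>

text \<open>The first projection maps the product measure to \<open>M\<close> because
  \<open>M\<close> has total mass 1; swapping coordinates gives the second.\<close>

lemma integral_prob_pair:
  fixes u :: "'a \<Rightarrow> real"
  assumes "prob_space M" "integrable M u"
  shows "integrable (M \<Otimes>\<^sub>M M) (\<lambda>z. u (fst z))"
    and "integrable (M \<Otimes>\<^sub>M M) (\<lambda>z. u (snd z))"
    and "(\<integral>z. u (fst z) \<partial>(M \<Otimes>\<^sub>M M)) = (\<integral>x. u x \<partial>M)"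
    and "(\<integral>z. u (snd z) \<partial>(M \<Otimes>\<^sub>M M)) = (\<integral>x. u x \<partial>M)"
proof -
  interpret prob_space M by fact
  interpret pair_sigma_finite M M ..
  have u[measurable]: "u \<in> borel_measurable M"
    using assms(2) by simp
  have "integrable (distr (M \<Otimes>\<^sub>M M) M fst) u"
    using assms(2) by (simp add: distr_pair_fst)
  then show 1: "integrable (M \<Otimes>\<^sub>M M) (\<lambda>z. u (fst z))"
    by (simp add: integrable_distr_eq)
  show "integrable (M \<Otimes>\<^sub>M M) (\<lambda>z. u (snd z))"
    using integrable_product_swap[OF 1] by (simp add: case_prod_beta')
  have "(\<integral>z. u (fst z) \<partial>(M \<Otimes>\<^sub>M M)) = (\<integral>x. u x \<partial>distr (M \<Otimes>\<^sub>M M) M fst)"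
    by (simp add: integral_distr)
  then show 2: "(\<integral>z. u (fst z) \<partial>(M \<Otimes>\<^sub>M M)) = (\<integral>x. u x \<partial>M)"
    by (simp add: distr_pair_fst)
  show "(\<integral>z. u (snd z) \<partial>(M \<Otimes>\<^sub>M M)) = (\<integral>x. u x \<partial>M)"
    using integral_product_swap[of "\<lambda>z. u (fst z)"] by (simp add: case_prod_beta' 2)
qed

text \<open>Only second moments are available, so first powers and, in the next lemma, products are
  dominated by squares.\<close>

lemma le_one_plus_square: "(a::real) \<le> 1 + a\<^sup>2"
proof -
  have "0 \<le> (a - 1 / 2)\<^sup>2" by simp
  then show ?thesis by (simp add: power2_eq_square algebra_simps)
qed

lemma mult_le_sum_squares: "(a::real) * b \<le> a\<^sup>2 + b\<^sup>2"
proof -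
  have "0 \<le> (a - b)\<^sup>2 + a\<^sup>2 + b\<^sup>2" by simp
  then show ?thesis by (simp add: power2_eq_square algebra_simps)
qed

text \<open>The analytic core, free of spectral notions. \<open>taylor\<close> carries the constant
  of the conclusion, with \<open>grad1 W y x\<close> as the gradient in the second variable;
  \<open>lip\<close> provides measurability and integrability.\<close>

lemma transport_smooth_interaction_energy:
  fixes W :: "real^'n \<Rightarrow> real^'n \<Rightarrow> real"
  assumes sym: "\<And>x y. W x y = W y x"
    and contW: "continuous_on UNIV (\<lambda>(x, y). W x y)"
    and "L \<ge> 0"
    and lip: "\<And>x y x' y'. norm (grad1 W x y - grad1 W x' y') \<le> L * (norm (x - x') + norm (y - y'))"
    and taylor: "\<And>x y x' y'.
      \<bar>W x' y' - W x y - grad1 W x y \<bullet> (x' - x) - grad1 W y x \<bullet> (y' - y)\<bar>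
        \<le> L / 2 * ((norm (x' - x))\<^sup>2 + (norm (y' - y))\<^sup>2)"
  shows "transport_smooth L (interaction_energy W) (interaction_gradient W)"
  unfolding transport_smooth_def
proof (intro ballI)
  fix \<mu> :: "(real^'n) measure" and S T
  assume "\<mu> \<in> P2" and S: "S \<in> L2_maps \<mu>" and T: "T \<in> L2_maps \<mu>"
  then have prob: "prob_space \<mu>" and sets[measurable_cong]: "sets \<mu> = sets borel"
    by (auto simp: P2_def)
  interpret prob_space \<mu> by (fact prob)
  interpret pair_sigma_finite \<mu> \<mu> ..
  interpret P: prob_space "\<mu> \<Otimes>\<^sub>M \<mu>"
    by (rule prob_space_pair) (fact prob)+
  let ?P = "\<mu> \<Otimes>\<^sub>M \<mu>"
  have [measurable]: "S \<in> borel_measurable \<mu>" "T \<in> borel_measurable \<mu>"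
    and sq: "integrable \<mu> (\<lambda>x. (norm (S x))\<^sup>2)" "integrable \<mu> (\<lambda>x. (norm (T x))\<^sup>2)"
    using S T by (auto simp: L2_maps_def)
  have W_meas: "(\<lambda>z. W (fst z) (snd z)) \<in> borel_measurable borel"
    using contW by (intro borel_measurable_continuous_onI) (simp add: case_prod_beta')
  have G_cont: "continuous_on UNIV (\<lambda>z. grad1 W (fst z) (snd z))"
  proof (rule lipschitz_on_continuous_on)
    \<comment> \<open>The factor 2 arises because each component norm is at most the norm of the
      pair.\<close>
    have "L * (norm (x - x') + norm (y - y')) \<le> 2 * L * norm ((x, y) - (x', y'))" for x y x' y' :: "real^'n"
      using norm_fst_le[of "x - x'" "y - y'"] norm_snd_le[of "y - y'" "x - x'"] \<open>L \<ge> 0\<close>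
        mult_left_mono[of "norm (x - x') + norm (y - y')" "2 * norm ((x, y) - (x', y'))" L]
      by simp
    then show "(2 * L)-lipschitz_on UNIV (\<lambda>z. grad1 W (fst z) (snd z))"
      using \<open>L \<ge> 0\<close> by (auto intro!: lipschitz_onI order_trans[OF lip] simp: dist_norm)
  qed
  have G_meas: "(\<lambda>z. grad1 W (fst z) (snd z)) \<in> borel_measurable borel"
    using G_cont by (rule borel_measurable_continuous_onI)
  have comp: "(\<lambda>z. g (fst z) (snd z)) \<in> borel_measurable borel \<Longrightarrow> a \<in> borel_measurable M \<Longrightarrow>
      b \<in> borel_measurable M \<Longrightarrow> (\<lambda>x. g (a x) (b x)) \<in> borel_measurable M"
    for g :: "real^'n \<Rightarrow> real^'n \<Rightarrow> 'b::topological_space" and a b and M :: "'c measure"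
    using measurable_compose[of "\<lambda>x. (a x, b x)" M borel "\<lambda>z. g (fst z) (snd z)" borel] by simp
  note [measurable] = comp[OF W_meas] comp[OF G_meas]

  \<comment> \<open>From the Taylor bound at the origin. Quadratic growth makes the energy a genuine
    integral instead of the default value 0.\<close>
  have W_growth: "\<exists>C. \<forall>a b. \<bar>W a b\<bar> \<le> C * (1 + (norm a)\<^sup>2 + (norm b)\<^sup>2)"
  proof (intro exI allI)
    fix a b
    let ?g = "norm (grad1 W 0 0)"
    have "\<bar>grad1 W 0 0 \<bullet> c\<bar> \<le> ?g * (1 + (norm c)\<^sup>2)" for c
      using Cauchy_Schwarz_ineq2[of "grad1 W 0 0" c] le_one_plus_square[of "norm c"]
        mult_left_mono[of "norm c" "1 + (norm c)\<^sup>2" ?g] by simp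
    note this[of a] this[of b]
    moreover have "\<bar>W a b\<bar> \<le> \<bar>W 0 0\<bar> + \<bar>grad1 W 0 0 \<bullet> a\<bar> + \<bar>grad1 W 0 0 \<bullet> b\<bar>
        + \<bar>W a b - W 0 0 - grad1 W 0 0 \<bullet> a - grad1 W 0 0 \<bullet> b\<bar>"
      by arith
    moreover have "\<bar>W a b - W 0 0 - grad1 W 0 0 \<bullet> a - grad1 W 0 0 \<bullet> b\<bar>
        \<le> L / 2 * ((norm a)\<^sup>2 + (norm b)\<^sup>2)"
      using taylor[of a b 0 0] by simp
    ultimately have "\<bar>W a b\<bar> \<le> \<bar>W 0 0\<bar> + ?g * (1 + (norm a)\<^sup>2) + ?g * (1 + (norm b)\<^sup>2)
        + L / 2 * ((norm a)\<^sup>2 + (norm b)\<^sup>2)"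
      by linarith
    also have "\<dots> \<le> (\<bar>W 0 0\<bar> + 2 * ?g + L / 2) * (1 + (norm a)\<^sup>2 + (norm b)\<^sup>2)"
      using \<open>L \<ge> 0\<close> by (simp add: algebra_simps)
    finally show "\<bar>W a b\<bar> \<le> (\<bar>W 0 0\<bar> + 2 * ?g + L / 2) * (1 + (norm a)\<^sup>2 + (norm b)\<^sup>2)" .
  qed
  have W_int: "integrable ?P (\<lambda>z. W (R (fst z)) (R (snd z)))"
    if [measurable]: "R \<in> borel_measurable \<mu>" and R: "integrable \<mu> (\<lambda>x. (norm (R x))\<^sup>2)" for R
  proof -
    obtain C where "\<forall>a b. \<bar>W a b\<bar> \<le> C * (1 + (norm a)\<^sup>2 + (norm b)\<^sup>2)"
      using W_growth by blast
    moreover have bound: "integrable ?P (\<lambda>z. C * (1 + (norm (R (fst z)))\<^sup>2 + (norm (R (snd z)))\<^sup>2))"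
      by (intro Bochner_Integration.integrable_add integrable_mult_right
          integral_prob_pair[OF prob R]) simp
    ultimately show ?thesis
      by (intro Bochner_Integration.integrable_bound[OF bound])
        (auto intro!: order_trans[OF _ abs_ge_self])
  qed
  have energy: "interaction_energy W (distr \<mu> borel R) = 1 / 2 * (\<integral>z. W (R (fst z)) (R (snd z)) \<partial>?P)"
    if [measurable]: "R \<in> borel_measurable \<mu>" and R: "integrable \<mu> (\<lambda>x. (norm (R x))\<^sup>2)" for R
  proof -
    \<comment> \<open>The image measure is sigma-finite, which makes the inner integral measurable
      in \<open>y\<close>.\<close>
    interpret D: prob_space "distr \<mu> borel R"
      by (rule prob_space_distr) simp
    have "(\<integral>y. (\<integral>x. W x y \<partial>distr \<mu> borel R) \<partial>distr \<mu> borel R)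
        = (\<integral>y. (\<integral>x. W x (R y) \<partial>distr \<mu> borel R) \<partial>\<mu>)"
      by (rule integral_distr) measurable
    \<comment> \<open>The energy integrates the first argument innermost; symmetry of
      \<open>W\<close> turns the outer variable into the first coordinate, as Fubini requires
      here.\<close>
    also have "\<dots> = (\<integral>y. (\<integral>x. W (R y) (R x) \<partial>\<mu>) \<partial>\<mu>)"
      by (subst integral_distr) (simp_all add: sym[of "R _" "R _"])
    also have "\<dots> = (\<integral>z. W (R (fst z)) (R (snd z)) \<partial>?P)"
      using integral_fst'[OF W_int[OF that]] by simp
    finally show ?thesis
      by (simp add: interaction_energy_def)
  qed

  define D where "D x = (norm (T x - S x))\<^sup>2" for x
  define h where "h x y = grad1 W (S x) (S y) \<bullet> (T x - S x)" for x y
  have [measurable]: "D \<in> borel_measurable \<mu>"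
    unfolding D_def by measurable
  have D_int: "integrable \<mu> D"
  proof (rule Bochner_Integration.integrable_bound)
    show "integrable \<mu> (\<lambda>x. 2 * (norm (T x))\<^sup>2 + 2 * (norm (S x))\<^sup>2)"
      using sq by simp
    have "(norm (a - b))\<^sup>2 \<le> 2 * (norm a)\<^sup>2 + 2 * (norm b)\<^sup>2" for a b :: "real^'n"
      using zero_le_power2[of "norm (a + b)"] unfolding power2_norm_eq_inner
      by (simp add: inner_diff inner_add inner_commute)
    then show "AE x in \<mu>. norm (D x) \<le> norm (2 * (norm (T x))\<^sup>2 + 2 * (norm (S x))\<^sup>2)"
      by (auto simp: D_def)
  qed simp
  have h_meas[measurable]: "(\<lambda>z. h (fst z) (snd z)) \<in> borel_measurable ?P"
    unfolding h_def by measurable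
  have h_int: "integrable ?P (\<lambda>z. h (fst z) (snd z))"
  proof -
    let ?g = "norm (grad1 W 0 0)"
    \<comment> \<open>Majorant from \<open>norm (grad1 W (S x) (S y)) \<le> ?g + L * (norm (S x) +
      norm (S y))\<close>, multiplied by the displacement at \<open>x\<close> and split into
      squares.\<close>
    let ?B = "\<lambda>z. ?g * (1 + D (fst z)) + L * ((norm (S (fst z)))\<^sup>2 + D (fst z))
      + L * ((norm (S (snd z)))\<^sup>2 + D (fst z))"
    have B: "integrable ?P ?B"
      by (intro Bochner_Integration.integrable_add integrable_mult_right
          integral_prob_pair[OF prob sq(1)] integral_prob_pair[OF prob D_int]) simp
    have "\<bar>h x y\<bar> \<le> ?B (x, y)" for x y
    proof -
      let ?d = "norm (T x - S x)"
      have "norm (grad1 W (S x) (S y)) \<le> ?g + L * (norm (S x) + norm (S y))"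
        using lip[of "S x" "S y" 0 0] norm_triangle_sub[of "grad1 W (S x) (S y)" "grad1 W 0 0"]
        by simp
      then have "\<bar>h x y\<bar> \<le> (?g + L * (norm (S x) + norm (S y))) * ?d"
        unfolding h_def by (meson Cauchy_Schwarz_ineq2 mult_right_mono norm_ge_zero order_trans)
      also have "\<dots> = ?g * ?d + L * (norm (S x) * ?d) + L * (norm (S y) * ?d)"
        by (simp add: algebra_simps)
      also have "\<dots> \<le> ?B (x, y)"
        using \<open>L \<ge> 0\<close> unfolding D_def fst_conv snd_conv
        by (intro add_mono mult_left_mono le_one_plus_square mult_le_sum_squares) auto
      finally show ?thesis .
    qed
    then show ?thesis
      by (intro Bochner_Integration.integrable_bound[OF B]) (auto intro!: order_trans[OF _ abs_ge_self])
  qed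
  have gradient: "(\<integral>x. interaction_gradient W (distr \<mu> borel S) (S x) \<bullet> (T x - S x) \<partial>\<mu>)
      = (\<integral>z. h (fst z) (snd z) \<partial>?P)"
  proof -
    have "interaction_gradient W (distr \<mu> borel S) (S x) \<bullet> (T x - S x) = (\<integral>y. h x y \<partial>\<mu>)" for x
    proof -
      \<comment> \<open>For fixed \<open>x\<close> this permits moving the inner product inside the
        Bochner integral.\<close>
      have "integrable \<mu> (\<lambda>y. grad1 W (S x) (S y))"
      proof (rule Bochner_Integration.integrable_bound)
        let ?g = "norm (grad1 W (S x) 0)"
        show "integrable \<mu> (\<lambda>y. ?g + L * (1 + (norm (S y))\<^sup>2))"
          using sq(1) by simp
        have "norm (grad1 W (S x) (S y)) \<le> ?g + L * (1 + (norm (S y))\<^sup>2)" for y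
          using lip[of "S x" "S y" "S x" 0] norm_triangle_sub[of "grad1 W (S x) (S y)" "grad1 W (S x) 0"]
            mult_left_mono[OF le_one_plus_square[of "norm (S y)"] \<open>L \<ge> 0\<close>]
          by simp
        then show "AE y in \<mu>. norm (grad1 W (S x) (S y)) \<le> norm (?g + L * (1 + (norm (S y))\<^sup>2))"
          by (auto intro!: order_trans[OF _ abs_ge_self])
      qed measurable
      then show ?thesis
        unfolding interaction_gradient_def h_def by (subst integral_distr) simp_all
    qed
    then show ?thesis
      using integral_fst'[OF h_int] by simp
  qed
  have h_swap: "integrable ?P (\<lambda>z. h (snd z) (fst z))"
    "(\<integral>z. h (snd z) (fst z) \<partial>?P) = (\<integral>z. h (fst z) (snd z) \<partial>?P)"
    using integrable_product_swap[OF h_int] integral_product_swap[OF h_meas]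
    by (simp_all add: case_prod_beta')
  note D_pair = integral_prob_pair[OF prob D_int]
  have "(\<integral>z. W (T (fst z)) (T (snd z)) \<partial>?P)
      \<le> (\<integral>z. W (S (fst z)) (S (snd z)) + (h (fst z) (snd z) + h (snd z) (fst z))
          + L / 2 * (D (fst z) + D (snd z)) \<partial>?P)"
  proof (rule integral_mono)
    show "W (T (fst z)) (T (snd z)) \<le> W (S (fst z)) (S (snd z)) + (h (fst z) (snd z) + h (snd z) (fst z))
          + L / 2 * (D (fst z) + D (snd z))" for z
      using taylor[of "T (fst z)" "T (snd z)" "S (fst z)" "S (snd z)"]
      unfolding h_def D_def by linarith
  qed (use W_int sq h_int h_swap D_pair in simp_all)
  \<comment> \<open>Each of the two terms in \<open>D\<close> contributes \<open>L / 2\<close>. The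
    factor \<open>1 / 2\<close> of the energy then turns \<open>2\<close> into 1 and
    \<open>L\<close> into \<open>L / 2\<close>.\<close>
  also have "\<dots> = (\<integral>z. W (S (fst z)) (S (snd z)) \<partial>?P) + 2 * (\<integral>z. h (fst z) (snd z) \<partial>?P)
      + L * (\<integral>x. D x \<partial>\<mu>)"
    using W_int[OF _ sq(1)] h_int h_swap D_pair by simp
  finally show "interaction_energy W (distr \<mu> borel T) - interaction_energy W (distr \<mu> borel S)
      \<le> (\<integral>x. interaction_gradient W (distr \<mu> borel S) (S x) \<bullet> (T x - S x) \<partial>\<mu>)
        + L / 2 * (\<integral>x. (norm (T x - S x))\<^sup>2 \<partial>\<mu>)"
    using sq by (simp add: energy gradient flip: D_def)
qed

section \<open>From the spectral bound to the Lipschitz and Taylor estimates\<close>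

theorem theorem4p8:
  fixes W :: "real^'n \<Rightarrow> real^'n \<Rightarrow> real"
  assumes "\<forall>x y. W x y = W y x"
    and "C2 (\<lambda>(x, y). W x y)"
    and "bdd_above (range (\<lambda>(x, y). spectral_radius (hessian W x y)))"
  shows "transport_smooth (SUP (x, y). spectral_radius (hessian W x y))
    (interaction_energy W) (interaction_gradient W)"
proof -
  let ?L = "SUP (x, y). spectral_radius (hessian W x y)"
  obtain f' :: "(real^'n) \<times> (real^'n) \<Rightarrow> ((real^'n) \<times> (real^'n)) \<Rightarrow>\<^sub>L real"
    and f'' :: "(real^'n) \<times> (real^'n) \<Rightarrow> ((real^'n) \<times> (real^'n)) \<Rightarrow>\<^sub>L ((real^'n) \<times> (real^'n)) \<Rightarrow>\<^sub>L real"
    where f': "\<And>z. ((\<lambda>(x, y). W x y) has_derivative f' z) (at z)"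
      and f'': "\<And>z. (f' has_derivative f'' z) (at z)"
    using assms(2) unfolding C2_def by blast
  have r: "spectral_radius (hessian W x y) \<le> ?L" for x y
    using cSUP_upper[OF UNIV_I assms(3), of "(x, y)"] by simp
  have lip: "norm (f' z - f' w) \<le> ?L * norm (z - w)" for z w
    using f' f'' r by (rule lipschitz_derivative)
  have "norm (f'' (0, 0)) \<le> ?L"
    using norm_second_derivative_le[OF f' f''] r order_trans by blast
  then have "?L \<ge> 0"
    using norm_ge_zero order_trans by blast
  have fst': "f' (x, y) (h, 0) = grad1 W x y \<bullet> h" for x y h
    using inner_grad1[OF f', of h x y] by (simp add: inner_commute)
  \<comment> \<open>\<open>W\<close> is invariant under swapping its arguments, so the chain rule
    gives a second expression for its derivative. Uniqueness then identifies the gradient in the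
    second variable at \<open>(x, y)\<close> with \<open>grad1 W y x\<close>.\<close>
  have "((\<lambda>(x, y). W x y) has_derivative (\<lambda>h. f' (y, x) (snd h, fst h))) (at (x, y))" for x y
  proof -
    have "((\<lambda>z. (\<lambda>(x, y). W x y) (snd z, fst z)) has_derivative (\<lambda>h. f' (y, x) (snd h, fst h))) (at (x, y))"
      by (rule has_derivative_compose[where g = "\<lambda>(x, y). W x y" and g' = "f' (y, x)"])
        (auto intro!: derivative_eq_intros f')
    then show ?thesis
      using assms(1) by (simp add: case_prod_beta')
  qed
  then have swap: "blinfun_apply (f' (x, y)) = (\<lambda>h. f' (y, x) (snd h, fst h))" for x y
    using f' has_derivative_unique by blast
  have snd': "f' (x, y) (0, h) = grad1 W y x \<bullet> h" for x y h
    using fun_cong[OF swap, of x y "(0, h)"] fst'[of y x h] by simp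
  show ?thesis
  proof (rule transport_smooth_interaction_energy)
    show "continuous_on UNIV (\<lambda>(x, y). W x y)"
      by (intro continuous_at_imp_continuous_on ballI has_derivative_continuous[OF f'])
    show "norm (grad1 W x y - grad1 W x' y') \<le> ?L * (norm (x - x') + norm (y - y'))" for x y x' y'
    proof -
      let ?v = "grad1 W x y - grad1 W x' y'"
      \<comment> \<open>Testing the difference of derivatives on \<open>(?v, 0)\<close> and dividing
        by \<open>norm ?v\<close> bounds the gradient difference by the operator norm.\<close>
      have "norm ?v * norm ?v = (f' (x, y) - f' (x', y')) (?v, 0)"
        by (simp add: blinfun.diff_left fst' inner_diff power2_eq_square[symmetric] power2_norm_eq_inner inner_commute)
      also have "\<dots> \<le> norm (f' (x, y) - f' (x', y')) * norm ?v"
        using norm_blinfun[of "f' (x, y) - f' (x', y')" "(?v, 0)"] by simp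
      finally have "norm ?v \<le> norm (f' (x, y) - f' (x', y'))"
        by (cases "?v = 0") (simp, simp)
      also have "\<dots> \<le> ?L * norm ((x, y) - (x', y'))"
        by (rule lip)
      also have "\<dots> \<le> ?L * (norm (x - x') + norm (y - y'))"
        using \<open>?L \<ge> 0\<close> norm_Pair_le[of "x - x'" "y - y'"] by (intro mult_left_mono) auto
      finally show ?thesis .
    qed
    show "\<bar>W x' y' - W x y - grad1 W x y \<bullet> (x' - x) - grad1 W y x \<bullet> (y' - y)\<bar>
        \<le> ?L / 2 * ((norm (x' - x))\<^sup>2 + (norm (y' - y))\<^sup>2)" for x y x' y'
    proof -
      \<comment> \<open>The squared norm of a pair is the sum of the squared component norms, so
        \<open>?L / 2\<close> passes over unchanged.\<close>
      have "f' (x, y) (x' - x, y' - y) = f' (x, y) (x' - x, 0) + f' (x, y) (0, y' - y)"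
        by (simp flip: blinfun.add_right)
      then show ?thesis
        using lipschitz_derivative_taylor_bound[OF f' lip, of "(x', y')" "(x, y)"]
        by (simp add: fst' snd' norm_Pair algebra_simps)
    qed
  qed (use assms(1) \<open>?L \<ge> 0\<close> in auto)
qed

end
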